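(* Let $G=(\{1,\dots,n\},E)$ be a finite simple graph and define $$\vartheta''(G)=\min\Big\{\max_{i\in\{1,\dots,n\}}\frac{1}{(c\cdot u^i)^2}:\ |c|=1,\ \{u^1,\dots,u^n\}\text{ is an orthonormal representation of }G\Big\}.$$ Then $\vartheta''(G)=\vartheta(G)$, the Lovász theta number of $G$.
   Context: An orthonormal representation of $G$ is a family of unit vectors $u^1,\dots,u^n$ (in a common space $\mathbb{R}^k$, for some $k$) such that $u^i\cdot u^j=0$ for all $i\neq j$ with $\{i,j\}\notin E$; the vector $c$ lies in the same space $\mathbb{R}^k$, and $1/0$ is read as $+\infty$. The Lovász theta number $\vartheta(G)$ is defined as the optimum value of $$\min\big\{t:\ \overline z_{ii}=t-1\ \forall i,\ \ \overline z_{ij}=-1\ \forall\{i,j\}\notin E\ (i\ne j),\ \ \overline Z\succeq 0\big\},$$ over $t\in\mathbb{R}$ and real symmetric $\overline Z=(\overline z_{ij})\in\mathbb{R}^{n\times n}$, where $\succeq0$ means positive semidefinite. *)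

theory Defs
  imports "Jordan_Normal_Form.Matrix" "HOL-Library.Extended_Real"
begin

(* Vertices are numbered {0..<n} rather than {1,...,n}, to agree with the indexing of
   vectors and matrices; an edge is a two-element set of vertices. *)
definition simple_graph :: "nat \<Rightarrow> nat set set \<Rightarrow> bool" where
  "simple_graph n E \<longleftrightarrow> (\<forall>e\<in>E. e \<subseteq> {0..<n} \<and> card e = 2)"

definition is_minimum :: "'a::order set \<Rightarrow> 'a \<Rightarrow> bool" where
  "is_minimum S m \<longleftrightarrow> m \<in> S \<and> (\<forall>x\<in>S. m \<le> x)"

definition vec_norm :: "real vec \<Rightarrow> real" where
  "vec_norm v = sqrt (v \<bullet> v)"

definition psd :: "nat \<Rightarrow> real mat \<Rightarrow> bool" where
  "psd n A \<longleftrightarrow> A \<in> carrier_mat n n \<and> transpose_mat A = A \<and>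
     (\<forall>x\<in>carrier_vec n. 0 \<le> x \<bullet> (A *\<^sub>v x))"

definition theta_feasible :: "nat \<Rightarrow> nat set set \<Rightarrow> real \<Rightarrow> real mat \<Rightarrow> bool" where
  "theta_feasible n E t Z \<longleftrightarrow>
     psd n Z \<and>
     (\<forall>i<n. Z $$ (i, i) = t - 1) \<and>
     (\<forall>i<n. \<forall>j<n. i \<noteq> j \<longrightarrow> {i, j} \<notin> E \<longrightarrow> Z $$ (i, j) = -1)"

definition theta_values :: "nat \<Rightarrow> nat set set \<Rightarrow> real set" where
  "theta_values n E = {t. \<exists>Z. theta_feasible n E t Z}"

definition lovasz_theta :: "nat \<Rightarrow> nat set set \<Rightarrow> real" where
  "lovasz_theta n E = Inf (theta_values n E)"

definition orthonormal_rep :: "nat \<Rightarrow> nat set set \<Rightarrow> nat \<Rightarrow> (nat \<Rightarrow> real vec) \<Rightarrow> bool" where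
  "orthonormal_rep n E k u \<longleftrightarrow>
     (\<forall>i<n. u i \<in> carrier_vec k \<and> vec_norm (u i) = 1) \<and>
     (\<forall>i<n. \<forall>j<n. i \<noteq> j \<longrightarrow> {i, j} \<notin> E \<longrightarrow> u i \<bullet> u j = 0)"

(* The quotient is taken in ereal, where 1 / 0 = \<infinity>. *)
definition rep_value :: "nat \<Rightarrow> real vec \<Rightarrow> (nat \<Rightarrow> real vec) \<Rightarrow> ereal" where
  "rep_value n c u = Max ((\<lambda>i. 1 / ereal ((c \<bullet> u i)\<^sup>2)) ` {0..<n})"

lemma one_divide_ereal_zero: "1 / ereal 0 = \<infinity>"
  by (simp add: divide_ereal_def one_ereal_def)

(* The dimension k of the common space is not fixed: it ranges over all naturals. *)
definition rep_values :: "nat \<Rightarrow> nat set set \<Rightarrow> ereal set" where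
  "rep_values n E =
     {rep_value n c u | k c u. c \<in> carrier_vec k \<and> vec_norm c = 1 \<and> orthonormal_rep n E k u}"

definition theta_rep :: "nat \<Rightarrow> nat set set \<Rightarrow> ereal" where
  "theta_rep n E = Inf (rep_values n E)"

end

theory Submission
  imports Defs
begin

text \<open>
  A matrix feasible for \<open>t\<close> is a Gram matrix of vectors \<open>w\<^sub>i\<close>. Adjoining one coordinate to them,
  the vectors \<open>u\<^sub>i = (w\<^sub>i, 1) / sqrt t\<close> form an orthonormal representation, and the last unit
  vector \<open>c\<close> satisfies \<open>1 / (c \<bullet> u\<^sub>i)\<^sup>2 = t\<close> for all \<open>i\<close>. Conversely, given \<open>c\<close> and \<open>u\<close> with finite
  value \<open>t\<close>, the vectors \<open>u\<^sub>i / (c \<bullet> u\<^sub>i) - c\<close> have inner products \<open>-1\<close> on non-edges and square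
  norms \<open>1 / (c \<bullet> u\<^sub>i)\<^sup>2 - 1 \<le> t - 1\<close>, so their Gram matrix becomes feasible for \<open>t\<close> after raising
  its diagonal. Hence the finite representation values are exactly the feasible \<open>t\<close>, and the
  minimum over these exists by compactness.
\<close>

section \<open>Positive semidefinite kernels\<close>

text \<open>Functions stand in for matrices so that an induction can pass from \<open>Suc n\<close>
  to \<open>n\<close> without reshaping; values at indices from \<open>n\<close> on are
  irrelevant.\<close>

definition psd_kernel :: "nat \<Rightarrow> (nat \<Rightarrow> nat \<Rightarrow> real) \<Rightarrow> bool" where
  "psd_kernel n K \<longleftrightarrow> (\<forall>i<n. \<forall>j<n. K i j = K j i) \<and>
     (\<forall>x. 0 \<le> (\<Sum>i<n. \<Sum>j<n. x i * K i j * x j))"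

lemma psd_kernel_sym: "psd_kernel n K \<Longrightarrow> i < n \<Longrightarrow> j < n \<Longrightarrow> K i j = K j i"
  by (simp add: psd_kernel_def)

lemma psd_kernel_nonneg: "psd_kernel n K \<Longrightarrow> 0 \<le> (\<Sum>i<n. \<Sum>j<n. x i * K i j * x j)"
  by (simp add: psd_kernel_def)

lemma psd_iff_psd_kernel:
  assumes A: "A \<in> carrier_mat n n"
  shows "psd n A \<longleftrightarrow> psd_kernel n (\<lambda>i j. A $$ (i, j))"
proof -
  have form: "x \<bullet> (A *\<^sub>v x) = (\<Sum>i<n. \<Sum>j<n. x $ i * A $$ (i, j) * x $ j)"
    if "x \<in> carrier_vec n" for x
    using that A
    by (auto simp: scalar_prod_def row_def sum_distrib_left mult.assoc lessThan_atLeast0 intro!: sum.cong)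
  have sym: "transpose_mat A = A \<longleftrightarrow> (\<forall>i<n. \<forall>j<n. A $$ (i, j) = A $$ (j, i))"
  proof
    assume "transpose_mat A = A"
    then show "\<forall>i<n. \<forall>j<n. A $$ (i, j) = A $$ (j, i)"
      using A by (metis carrier_matD index_transpose_mat(1))
  next
    assume "\<forall>i<n. \<forall>j<n. A $$ (i, j) = A $$ (j, i)"
    then show "transpose_mat A = A"
      using A by (intro eq_matI) auto
  qed
  have "(\<forall>x\<in>carrier_vec n. 0 \<le> x \<bullet> (A *\<^sub>v x)) \<longleftrightarrow>
      (\<forall>x. 0 \<le> (\<Sum>i<n. \<Sum>j<n. x i * A $$ (i, j) * x j))" (is "?L \<longleftrightarrow> ?R")
  proof
    assume L: ?L
    show ?R
    proof
      fix x
      show "0 \<le> (\<Sum>i<n. \<Sum>j<n. x i * A $$ (i, j) * x j)"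
        using bspec[OF L, of "vec n x"] form[of "vec n x"] by simp
    qed
  next
    assume ?R
    then show ?L using form by simp
  qed
  then show ?thesis
    using A sym by (simp add: psd_def psd_kernel_def)
qed

text \<open>The quadratic form is a sum of squares, one for each coordinate
  \<open>l\<close>.\<close>

lemma psd_kernel_gram: "psd_kernel n (\<lambda>i j. \<Sum>l<k. w i l * w j l)"
  unfolding psd_kernel_def
proof (intro conjI allI impI)
  fix x :: "nat \<Rightarrow> real"
  have "(\<Sum>i<n. \<Sum>j<n. x i * (\<Sum>l<k. w i l * w j l) * x j) =
      (\<Sum>i<n. \<Sum>j<n. \<Sum>l<k. (x i * w i l) * (x j * w j l))"
    by (simp add: sum_distrib_left sum_distrib_right algebra_simps)
  also have "\<dots> = (\<Sum>i<n. \<Sum>l<k. \<Sum>j<n. (x i * w i l) * (x j * w j l))"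
    by (intro sum.cong refl sum.swap)
  also have "\<dots> = (\<Sum>l<k. \<Sum>i<n. \<Sum>j<n. (x i * w i l) * (x j * w j l))"
    by (rule sum.swap)
  also have "\<dots> = (\<Sum>l<k. (\<Sum>i<n. x i * w i l)\<^sup>2)"
    by (simp add: power2_eq_square sum_product)
  finally show "0 \<le> (\<Sum>i<n. \<Sum>j<n. x i * (\<Sum>l<k. w i l * w j l) * x j)"
    by (simp add: sum_nonneg)
qed (simp add: mult.commute)

lemma psd_kernel_add_diag:
  assumes "psd_kernel n K" and "\<And>i. i < n \<Longrightarrow> 0 \<le> d i"
  shows "psd_kernel n (\<lambda>i j. K i j + (if i = j then d i else 0))"
  unfolding psd_kernel_def
proof (intro conjI allI impI)
  fix x :: "nat \<Rightarrow> real"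
  have "(\<Sum>i<n. \<Sum>j<n. x i * (K i j + (if i = j then d i else 0)) * x j) =
      (\<Sum>i<n. \<Sum>j<n. x i * K i j * x j) + (\<Sum>i<n. \<Sum>j<n. if i = j then x i * d i * x i else 0)"
    unfolding sum.distrib[symmetric] by (intro sum.cong refl) (auto simp: algebra_simps)
  also have "(\<Sum>i<n. \<Sum>j<n. if i = j then x i * d i * x i else 0) = (\<Sum>i<n. d i * (x i)\<^sup>2)"
    by (intro sum.cong refl) (simp add: power2_eq_square)
  finally show "0 \<le> (\<Sum>i<n. \<Sum>j<n. x i * (K i j + (if i = j then d i else 0)) * x j)"
    using assms by (auto intro!: add_nonneg_nonneg sum_nonneg psd_kernel_nonneg mult_nonneg_nonneg)
qed (use assms in \<open>auto simp: psd_kernel_sym\<close>)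

section \<open>Entry bounds from test vectors with small support\<close>

lemma quadratic_form_two_points:
  fixes K :: "nat \<Rightarrow> nat \<Rightarrow> real"
  assumes "i < n" "j < n" "i \<noteq> j"
  shows "(\<Sum>p<n. \<Sum>q<n. ((\<lambda>_. 0)(i := a, j := b)) p * K p q * ((\<lambda>_. 0)(i := a, j := b)) q) =
    a * a * K i i + a * b * K i j + a * b * K j i + b * b * K j j"
proof -
  have two: "(\<Sum>p<n. ((\<lambda>_. 0)(i := a, j := b)) p * f p) = a * f i + b * f j" for f :: "nat \<Rightarrow> real"
  proof -
    have "(\<Sum>p<n. ((\<lambda>_. 0)(i := a, j := b)) p * f p) =
        (\<Sum>p\<in>{i, j}. ((\<lambda>_. 0)(i := a, j := b)) p * f p)"
      using assms by (intro sum.mono_neutral_right) auto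
    then show ?thesis using assms by simp
  qed
  have "(\<Sum>p<n. \<Sum>q<n. ((\<lambda>_. 0)(i := a, j := b)) p * K p q * ((\<lambda>_. 0)(i := a, j := b)) q) =
      (\<Sum>p<n. ((\<lambda>_. 0)(i := a, j := b)) p * (\<Sum>q<n. ((\<lambda>_. 0)(i := a, j := b)) q * K p q))"
    unfolding sum_distrib_left by (intro sum.cong refl) (simp only: mult_ac)
  then show ?thesis
    by (simp only: two) (simp add: algebra_simps)
qed

lemma psd_kernel_two_points:
  assumes "psd_kernel n K" "i < n" "j < n" "i \<noteq> j"
  shows "0 \<le> a\<^sup>2 * K i i + 2 * a * b * K i j + b\<^sup>2 * K j j"
  using psd_kernel_nonneg[OF assms(1), of "(\<lambda>_. 0)(i := a, j := b)"]
    quadratic_form_two_points[OF assms(2-4), of a b K] psd_kernel_sym[OF assms(1-3)]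
  by (simp add: power2_eq_square algebra_simps)

lemma psd_kernel_diag_nonneg:
  assumes "psd_kernel n K" "i < n"
  shows "0 \<le> K i i"
proof -
  have "(\<Sum>p<n. \<Sum>q<n. (if p = i then 1 else 0) * K p q * (if q = i then 1 else 0)) =
      (\<Sum>p<n. \<Sum>q<n. if q = i then (if p = i then K i i else 0) else 0)"
    by (intro sum.cong refl) auto
  also have "\<dots> = K i i" using assms(2) by simp
  finally show ?thesis
    using psd_kernel_nonneg[OF assms(1), of "\<lambda>p. if p = i then 1 else 0"] by simp
qed

text \<open>The test vectors are the sum and the difference of two unit vectors. The diagonal thus
  controls all entries, which is what compactness requires later.\<close>

lemma psd_kernel_entry_bound:
  assumes K: "psd_kernel n K" and "i < n" "j < n"
  shows "2 * \<bar>K i j\<bar> \<le> K i i + K j j"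
proof (cases "i = j")
  case True
  then show ?thesis using psd_kernel_diag_nonneg[OF K] assms by simp
next
  case False
  show ?thesis
    using psd_kernel_two_points[OF assms False, of 1 1]
      psd_kernel_two_points[OF assms False, of 1 "-1"] by simp
qed

text \<open>With \<open>K j j = 0\<close> the two-point form is affine in the coefficient
  \<open>b\<close>, so it stays nonnegative only if its slope vanishes.\<close>

lemma psd_kernel_zero_diag:
  assumes K: "psd_kernel n K" and "i < n" "j < n" and "K j j = 0"
  shows "K i j = 0"
proof (cases "i = j")
  case False
  have "0 \<le> (K i j)\<^sup>2 * K i i + 2 * K i j * b * K i j" for b
    using psd_kernel_two_points[OF assms(1-3) False, of "K i j" b] assms by simp
  \<comment> \<open>This value of \<open>b\<close> turns the right-hand side into
    \<open>- (K i j)\<^sup>2\<close>.\<close>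
  from this[of "- (K i i + 1) / 2"] have "(K i j)\<^sup>2 \<le> 0"
    by (simp add: power2_eq_square field_simps)
  then show ?thesis by simp
qed (use assms in simp)

section \<open>Schur complement and Gram factorization\<close>

text \<open>In the degenerate case \<open>K n n = 0\<close> the subtracted term is \<open>0\<close> by the convention \<open>x / 0 = 0\<close>.\<close>

lemma psd_kernel_schur_complement:
  assumes K: "psd_kernel (Suc n) K"
  shows "psd_kernel n (\<lambda>i j. K i j - K i n * K j n / K n n)"
  unfolding psd_kernel_def
proof (intro conjI allI impI)
  fix i j assume "i < n" "j < n"
  then show "K i j - K i n * K j n / K n n = K j i - K j n * K i n / K n n"
    using psd_kernel_sym[OF K, of i j] by simp
next
  fix x :: "nat \<Rightarrow> real"
  let ?s = "\<Sum>i<n. x i * K i n"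
  \<comment> \<open>Completing the square: if \<open>K n n > 0\<close>, this last coordinate
    minimises the form of \<open>K\<close> over all extensions of \<open>x\<close>, and the minimum
    is the form of the Schur complement at \<open>x\<close>.\<close>
  define y where "y = x(n := - ?s / K n n)"
  have y: "y i = x i" if "i < n" for i using that by (simp add: y_def)
  have s': "(\<Sum>j<n. K n j * x j) = ?s"
    using psd_kernel_sym[OF K, of n] by (intro sum.cong) auto
  have s0: "?s = 0" if "K n n = 0"
    using psd_kernel_zero_diag[OF K, of _ n] that by simp
  have "(\<Sum>i<Suc n. \<Sum>j<Suc n. y i * K i j * y j) =
      (\<Sum>i<n. \<Sum>j<n. x i * K i j * x j) + ?s * y n + y n * (\<Sum>j<n. K n j * x j) + y n * K n n * y n"
    by (simp add: sum.distrib y sum_distrib_left sum_distrib_right mult.assoc)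
  also have "\<dots> = (\<Sum>i<n. \<Sum>j<n. x i * K i j * x j) - ?s * ?s / K n n"
    using s0 unfolding s' by (cases "K n n = 0") (simp_all add: y_def field_simps)
  also have "?s * ?s / K n n = (\<Sum>i<n. \<Sum>j<n. x i * (K i n * K j n / K n n) * x j)"
    by (simp add: sum_product sum_divide_distrib mult_ac)
  also have "(\<Sum>i<n. \<Sum>j<n. x i * K i j * x j) - \<dots> =
      (\<Sum>i<n. \<Sum>j<n. x i * (K i j - K i n * K j n / K n n) * x j)"
    by (simp add: sum_subtractf algebra_simps)
  finally show "0 \<le> (\<Sum>i<n. \<Sum>j<n. x i * (K i j - K i n * K j n / K n n) * x j)"
    using psd_kernel_nonneg[OF K, of y] by simp
qed

text \<open>Cholesky factorization by induction: coordinate \<open>n\<close> accounts for the last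
  row and column, and the induction hypothesis factors the Schur complement that remains.\<close>

lemma psd_kernel_gram_representation:
  assumes "psd_kernel n K"
  shows "\<exists>w. \<forall>i<n. \<forall>j<n. K i j = (\<Sum>l<n. w i l * w j l)"
  using assms
proof (induction n arbitrary: K)
  case 0
  then show ?case by simp
next
  case (Suc n)
  have pos: "0 \<le> K n n" using psd_kernel_diag_nonneg[OF Suc.prems] by simp
  obtain w where w: "\<And>i j. i < n \<Longrightarrow> j < n \<Longrightarrow>
      K i j - K i n * K j n / K n n = (\<Sum>l<n. w i l * w j l)"
    using Suc.IH[OF psd_kernel_schur_complement[OF Suc.prems]] by blast
  \<comment> \<open>The last vector is zero in all coordinates below \<open>n\<close>; the others
    keep the coordinates of \<open>w\<close> and gain the scaled pivot column. If
    \<open>K n n = 0\<close>, coordinate \<open>n\<close> is \<open>0\<close> throughout.\<close>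
  define v where "v i l = (if l = n then K i n / sqrt (K n n) else if i = n then 0 else w i l)" for i l
  have last: "v i n * v j n = K i n * K j n / K n n" for i j
    using pos by (simp add: v_def)
  \<comment> \<open>Cancellation is immediate for \<open>K n n \<noteq> 0\<close>; otherwise the
    quotient is \<open>0\<close> by convention and \<open>K i n\<close> vanishes as well.\<close>
  have pivot: "K i n * K n n / K n n = K i n" if "i < Suc n" for i
    using psd_kernel_zero_diag[OF Suc.prems that, of n] by (cases "K n n = 0") auto
  have "K i j = (\<Sum>l<Suc n. v i l * v j l)" if ij: "i < Suc n" "j < Suc n" for i j
  proof (cases "i < n \<and> j < n")
    case True
    have "(\<Sum>l<n. v i l * v j l) = (\<Sum>l<n. w i l * w j l)"
      using True by (intro sum.cong) (auto simp: v_def)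
    then show ?thesis using w[of i j] True last[of i j] by simp
  next
    case False
    then have "(\<Sum>l<n. v i l * v j l) = 0"
      using ij by (intro sum.neutral) (auto simp: v_def)
    moreover have "K i n * K j n / K n n = K i j"
      using False ij pivot[of i] pivot[of j] psd_kernel_sym[OF Suc.prems, of i j]
      by (cases "j = n") (auto simp: mult.commute less_Suc_eq)
    ultimately show ?thesis using last[of i j] by simp
  qed
  then show ?case by blast
qed

section \<open>Feasible values of the theta program and attainment of their infimum\<close>

lemma mem_theta_values_iff:
  "t \<in> theta_values n E \<longleftrightarrow> (\<exists>K. psd_kernel n K \<and> (\<forall>i<n. K i i = t - 1) \<and>
     (\<forall>i<n. \<forall>j<n. i \<noteq> j \<longrightarrow> {i, j} \<notin> E \<longrightarrow> K i j = -1))" (is "_ \<longleftrightarrow> ?R")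
proof
  assume "t \<in> theta_values n E"
  then obtain Z where Z: "theta_feasible n E t Z" by (auto simp: theta_values_def)
  then have "psd_kernel n (\<lambda>i j. Z $$ (i, j))"
    using psd_iff_psd_kernel by (auto simp: theta_feasible_def psd_def)
  with Z show ?R by (auto simp: theta_feasible_def)
next
  assume ?R
  then obtain K where K: "psd_kernel n K" "\<forall>i<n. K i i = t - 1"
    "\<forall>i<n. \<forall>j<n. i \<noteq> j \<longrightarrow> {i, j} \<notin> E \<longrightarrow> K i j = -1" by blast
  define Z where "Z = mat n n (\<lambda>(i, j). K i j)"
  have "psd_kernel n (\<lambda>i j. Z $$ (i, j))"
    using K(1) by (simp add: psd_kernel_def Z_def)
  then have "psd n Z"
    using psd_iff_psd_kernel[of Z n] by (simp add: Z_def)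
  then have "theta_feasible n E t Z"
    using K by (simp add: theta_feasible_def Z_def)
  then show "t \<in> theta_values n E" by (auto simp: theta_values_def)
qed

text \<open>A diagonal entry \<open>t - 1\<close> is nonnegative. Without vertices there is no such
  entry, and every real would be feasible.\<close>

lemma theta_values_ge_1:
  assumes "n \<ge> 1" "t \<in> theta_values n E"
  shows "1 \<le> t"
  using assms psd_kernel_diag_nonneg[of n _ 0] by (fastforce simp: mem_theta_values_iff)

text \<open>Bolzano-Weierstrass, one member of the family at a time: each refinement makes one more
  sequence monotone and bounded, and the earlier limits survive passing to a subsequence.\<close>

lemma convergent_subseq_finite_family:
  fixes a :: "'i \<Rightarrow> nat \<Rightarrow> real"
  assumes "finite I" and "\<And>i k. i \<in> I \<Longrightarrow> \<bar>a i k\<bar> \<le> M"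
  shows "\<exists>r. strict_mono r \<and> (\<forall>i\<in>I. convergent (\<lambda>k. a i (r k)))"
  using assms
proof (induction I)
  case empty
  then show ?case using strict_mono_id by auto
next
  case (insert i I)
  then obtain r where r: "strict_mono r" "\<forall>i\<in>I. convergent (\<lambda>k. a i (r k))" by auto
  obtain s where s: "strict_mono s" "monoseq (\<lambda>k. a i (r (s k)))"
    using seq_monosub[of "\<lambda>k. a i (r k)"] by blast
  have "Bseq (\<lambda>k. a i (r (s k)))"
    using insert.prems by (intro BseqI'[of _ M]) simp
  then have "convergent (\<lambda>k. a i (r (s k)))"
    using s(2) Bseq_monoseq_convergent by blast
  moreover have "convergent (\<lambda>k. a j (r (s k)))" if "j \<in> I" for j
    using r(2) that convergent_subseq_convergent[of "\<lambda>k. a j (r k)" s] s(1) by (auto simp: o_def)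
  moreover have "strict_mono (r \<circ> s)"
    using r(1) s(1) by (rule strict_mono_o)
  ultimately show ?case by (intro exI[of _ "r \<circ> s"]) (simp add: o_def)
qed

lemma theta_values_nonempty: "theta_values n E \<noteq> {}"
proof -
  \<comment> \<open>The kernel \<open>n\<close> times the identity minus the all-ones matrix has
    \<open>-1\<close> everywhere off the diagonal, so it is feasible for \<open>t = n\<close>
    whatever \<open>E\<close> is.\<close>
  have "psd_kernel n (\<lambda>i j. (if i = j then real n else 0) - 1)"
    unfolding psd_kernel_def
  proof (intro conjI allI impI)
    fix x :: "nat \<Rightarrow> real"
    have "(\<Sum>i<n. \<Sum>j<n. x i * ((if i = j then real n else 0) - 1) * x j) =
        (\<Sum>i<n. \<Sum>j<n. if i = j then real n * (x i)\<^sup>2 else 0) - (\<Sum>i<n. \<Sum>j<n. x i * x j)"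
      unfolding sum_subtractf[symmetric]
      by (intro sum.cong refl) (auto simp: algebra_simps power2_eq_square)
    also have "\<dots> = real n * (\<Sum>i<n. (x i)\<^sup>2) - (\<Sum>i<n. \<Sum>j<n. x i * x j)"
      by (simp add: sum_distrib_left)
    finally have form: "(\<Sum>i<n. \<Sum>j<n. x i * ((if i = j then real n else 0) - 1) * x j) =
        real n * (\<Sum>i<n. (x i)\<^sup>2) - (\<Sum>i<n. \<Sum>j<n. x i * x j)" .
    have "(\<Sum>i<n. \<Sum>j<n. x i * x j) \<le> (\<Sum>i<n. \<Sum>j<n. ((x i)\<^sup>2 + (x j)\<^sup>2) / 2)"
      using sum_squares_bound by (intro sum_mono) (simp add: field_simps)
    also have "\<dots> = real n * (\<Sum>i<n. (x i)\<^sup>2)"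
      by (simp add: sum.distrib add_divide_distrib flip: sum_divide_distrib sum_distrib_left)
    finally show "0 \<le> (\<Sum>i<n. \<Sum>j<n. x i * ((if i = j then real n else 0) - 1) * x j)"
      using form by simp
  qed auto
  then have "real n \<in> theta_values n E"
    unfolding mem_theta_values_iff by (intro exI conjI) auto
  then show ?thesis by blast
qed

text \<open>Kernels for a minimising sequence of values have bounded entries; a subsequence
  converges entrywise, and all the constraints survive in the limit.\<close>

lemma is_minimum_lovasz_theta:
  assumes n: "n \<ge> 1"
  shows "is_minimum (theta_values n E) (lovasz_theta n E)"
proof -
  let ?T = "theta_values n E" and ?m = "lovasz_theta n E"
  have bdd: "bdd_below ?T" using theta_values_ge_1[OF n] by (rule bdd_belowI)
  have lower: "?m \<le> t" if "t \<in> ?T" for t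
    unfolding lovasz_theta_def using that bdd by (rule cInf_lower)
  have "\<exists>t\<in>?T. t < ?m + 1 / real (Suc k)" for k
    using cInf_lessD[OF theta_values_nonempty, of n E "?m + 1 / real (Suc k)"]
    by (simp add: lovasz_theta_def)
  then obtain t where t: "\<And>k. t k \<in> ?T" "\<And>k. t k < ?m + 1 / real (Suc k)" by metis
  have t_lim: "t \<longlonglongrightarrow> ?m"
  proof (rule tendsto_sandwich[OF _ _ tendsto_const])
    show "(\<lambda>k. ?m + 1 / real (Suc k)) \<longlonglongrightarrow> ?m"
      using tendsto_add[OF tendsto_const LIMSEQ_Suc[OF lim_1_over_n], of ?m] by simp
    show "\<forall>\<^sub>F k in sequentially. ?m \<le> t k" using t(1) lower by simp
    show "\<forall>\<^sub>F k in sequentially. t k \<le> ?m + 1 / real (Suc k)"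
      using t(2) less_imp_le by (intro always_eventually) blast
  qed
  obtain K where K: "\<And>k. psd_kernel n (K k)" "\<And>k i. i < n \<Longrightarrow> K k i i = t k - 1"
    "\<And>k i j. i < n \<Longrightarrow> j < n \<Longrightarrow> i \<noteq> j \<Longrightarrow> {i, j} \<notin> E \<Longrightarrow> K k i j = -1"
    using t(1) unfolding mem_theta_values_iff by metis
  \<comment> \<open>Both diagonal entries equal \<open>t k - 1\<close>, and the slack
    \<open>1 / real (Suc k)\<close> is at most \<open>1\<close>, so the bound is uniform in
    \<open>k\<close>.\<close>
  have bound: "\<bar>K k i j\<bar> \<le> ?m" if "i < n" "j < n" for k i j
  proof -
    have "\<bar>K k i j\<bar> \<le> t k - 1"
      using psd_kernel_entry_bound[OF K(1) that, of k] K(2) that by simp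
    moreover have "t k \<le> ?m + 1"
      using t(2)[of k] by (rule order.trans[OF less_imp_le]) simp
    ultimately show ?thesis by simp
  qed
  obtain r where r: "strict_mono r"
    "\<forall>p\<in>{..<n} \<times> {..<n}. convergent (\<lambda>k. K (r k) (fst p) (snd p))"
    using convergent_subseq_finite_family
        [of "{..<n} \<times> {..<n}" "\<lambda>p k. K k (fst p) (snd p)" ?m] bound by auto
  define L where "L i j = lim (\<lambda>k. K (r k) i j)" for i j
  have L: "(\<lambda>k. K (r k) i j) \<longlonglongrightarrow> L i j" if "i < n" "j < n" for i j
    using r(2) that unfolding L_def by (auto simp: convergent_LIMSEQ_iff)
  have t_sub: "(\<lambda>k. t (r k)) \<longlonglongrightarrow> ?m"
    using LIMSEQ_subseq_LIMSEQ[OF t_lim r(1)] by (simp add: o_def)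
  have "psd_kernel n L"
    unfolding psd_kernel_def
  proof (intro conjI allI impI)
    fix i j assume "i < n" "j < n"
    then show "L i j = L j i" using psd_kernel_sym[OF K(1)] by (simp add: L_def)
  next
    fix x :: "nat \<Rightarrow> real"
    have "(\<lambda>k. \<Sum>i<n. \<Sum>j<n. x i * K (r k) i j * x j) \<longlonglongrightarrow> (\<Sum>i<n. \<Sum>j<n. x i * L i j * x j)"
      by (intro tendsto_intros L) auto
    then show "0 \<le> (\<Sum>i<n. \<Sum>j<n. x i * L i j * x j)"
      by (rule LIMSEQ_le_const) (use psd_kernel_nonneg[OF K(1)] in blast)
  qed
  moreover have "L i i = ?m - 1" if "i < n" for i
    using L[OF that that] tendsto_diff[OF t_sub tendsto_const, of 1] K(2)[OF that]
    by (auto intro: LIMSEQ_unique)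
  moreover have "L i j = -1" if "i < n" "j < n" "i \<noteq> j" "{i, j} \<notin> E" for i j
    using L[OF that(1,2)] K(3)[OF that] by (simp add: LIMSEQ_const_iff)
  ultimately have "?m \<in> ?T" unfolding mem_theta_values_iff by blast
  then show ?thesis using lower by (simp add: is_minimum_def)
qed

section \<open>Feasible values versus values of orthonormal representations\<close>

lemma theta_value_imp_rep_value:
  assumes n: "n \<ge> 1" and t: "t \<in> theta_values n E"
  shows "ereal t \<in> rep_values n E"
proof -
  obtain K where K: "psd_kernel n K" "\<And>i. i < n \<Longrightarrow> K i i = t - 1"
    "\<And>i j. i < n \<Longrightarrow> j < n \<Longrightarrow> i \<noteq> j \<Longrightarrow> {i, j} \<notin> E \<Longrightarrow> K i j = -1"
    using t unfolding mem_theta_values_iff by blast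
  obtain w where w: "\<And>i j. i < n \<Longrightarrow> j < n \<Longrightarrow> K i j = (\<Sum>l<n. w i l * w j l)"
    using psd_kernel_gram_representation[OF K(1)] by blast
  have t1: "1 \<le> t" using theta_values_ge_1[OF n t] .
  \<comment> \<open>The extra coordinate \<open>1\<close> adds \<open>1\<close> to every Gram entry:
    non-edges become \<open>0\<close> and the diagonal becomes \<open>t\<close>, which
    \<open>sqrt t\<close> normalises.\<close>
  define u where "u i = vec (Suc n) (\<lambda>l. (if l = n then 1 else w i l) / sqrt t)" for i
  define c where "c = (unit_vec (Suc n) n :: real vec)"
  have uu: "u i \<bullet> u j = (K i j + 1) / t" if "i < n" "j < n" for i j
  proof -
    have "u i \<bullet> u j = (\<Sum>l<n. w i l / sqrt t * (w j l / sqrt t)) + 1 / sqrt t * (1 / sqrt t)"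
      by (simp add: u_def scalar_prod_def lessThan_atLeast0)
    also have "\<dots> = (\<Sum>l<n. w i l * w j l / t) + 1 / t"
      using t1 by simp
    finally show ?thesis
      using w[OF that] by (simp add: sum_divide_distrib add_divide_distrib)
  qed
  have cu: "(c \<bullet> u i)\<^sup>2 = 1 / t" for i
    using t1 by (simp add: c_def u_def power_divide)
  have "orthonormal_rep n E (Suc n) u"
    unfolding orthonormal_rep_def vec_norm_def
    using uu K t1 by (auto simp: u_def)
  moreover have "vec_norm c = 1" "c \<in> carrier_vec (Suc n)"
    by (simp_all add: vec_norm_def c_def)
  moreover have "ereal t = rep_value n c u"
  proof -
    have "(\<lambda>i. 1 / ereal ((c \<bullet> u i)\<^sup>2)) ` {0..<n} = {ereal t}"
      using n t1 by (simp add: cu one_ereal_def image_constant_conv)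
    then show ?thesis by (simp add: rep_value_def)
  qed
  ultimately show ?thesis unfolding rep_values_def by blast
qed

lemma finite_rep_value_imp_theta_value:
  assumes n: "n \<ge> 1" and v: "v \<in> rep_values n E" and "v \<noteq> \<infinity>"
  shows "\<exists>t\<in>theta_values n E. v = ereal t"
proof -
  obtain k c u where v_eq: "v = rep_value n c u" and c: "c \<in> carrier_vec k" "vec_norm c = 1"
    and u: "orthonormal_rep n E k u"
    using v unfolding rep_values_def by blast
  let ?S = "(\<lambda>i. 1 / ereal ((c \<bullet> u i)\<^sup>2)) ` {0..<n}"
  have le: "1 / ereal ((c \<bullet> u i)\<^sup>2) \<le> v" if "i < n" for i
    unfolding v_eq rep_value_def using that by (intro Max_ge) auto
  \<comment> \<open>A vanishing inner product would contribute \<open>1 / 0 = \<infinity>\<close> to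
    the maximum.\<close>
  have nz: "c \<bullet> u i \<noteq> 0" if "i < n" for i
    using le[OF that] \<open>v \<noteq> \<infinity>\<close> one_divide_ereal_zero by force
  have "v \<in> ?S" unfolding v_eq rep_value_def using n by (intro Max_in) auto
  then obtain t where t: "v = ereal t"
    using nz by (auto simp: one_ereal_def)
  have le_t: "1 / (c \<bullet> u i)\<^sup>2 \<le> t" if "i < n" for i
    using le[OF that] nz[OF that] by (simp add: t one_ereal_def)
  have uc: "u i \<in> carrier_vec k" "u i \<bullet> u i = 1" if "i < n" for i
    using u that by (auto simp: orthonormal_rep_def vec_norm_def)
  have cc: "c \<bullet> c = 1" using c(2) by (simp add: vec_norm_def)
  \<comment> \<open>Scaling gives \<open>u i\<close> the component \<open>c\<close> along
    \<open>c\<close>; subtracting it leaves a vector orthogonal to \<open>c\<close>. In the inner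
    products the two cross terms and \<open>c \<bullet> c\<close> are each \<open>1\<close> in size,
    leaving the \<open>- 1\<close> of \<open>ww\<close>.\<close>
  define w where "w i l = u i $ l / (c \<bullet> u i) - c $ l" for i l
  have ww: "(\<Sum>l<k. w i l * w j l) = u i \<bullet> u j / ((c \<bullet> u i) * (c \<bullet> u j)) - 1"
    if ij: "i < n" "j < n" for i j
  proof -
    have sp: "x \<bullet> y = (\<Sum>l<k. x $ l * y $ l)" if "y \<in> carrier_vec k" for x y :: "real vec"
      using that by (simp add: scalar_prod_def lessThan_atLeast0)
    have "(\<Sum>l<k. w i l * w j l) = (\<Sum>l<k. u i $ l * u j $ l / ((c \<bullet> u i) * (c \<bullet> u j))
        - c $ l * u i $ l / (c \<bullet> u i) - c $ l * u j $ l / (c \<bullet> u j) + c $ l * c $ l)"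
      by (intro sum.cong refl) (simp add: w_def algebra_simps)
    also have "\<dots> = (\<Sum>l<k. u i $ l * u j $ l) / ((c \<bullet> u i) * (c \<bullet> u j))
        - (\<Sum>l<k. c $ l * u i $ l) / (c \<bullet> u i) - (\<Sum>l<k. c $ l * u j $ l) / (c \<bullet> u j)
        + (\<Sum>l<k. c $ l * c $ l)"
      by (simp only: sum.distrib sum_subtractf sum_divide_distrib)
    also have "\<dots> = u i \<bullet> u j / ((c \<bullet> u i) * (c \<bullet> u j))
        - (c \<bullet> u i) / (c \<bullet> u i) - (c \<bullet> u j) / (c \<bullet> u j) + c \<bullet> c"
      using uc ij c(1) by (simp only: sp)
    finally show ?thesis using nz ij cc by simp
  qed
  \<comment> \<open>The slack on the diagonal is nonnegative by \<open>le_t\<close> and lifts each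
    entry to exactly \<open>t - 1\<close>; the off-diagonal entries are untouched.\<close>
  define K where "K i j = (\<Sum>l<k. w i l * w j l) + (if i = j then t - 1 / (c \<bullet> u i)\<^sup>2 else 0)" for i j
  have "psd_kernel n K"
    unfolding K_def by (intro psd_kernel_add_diag psd_kernel_gram) (use le_t in simp)
  moreover have "K i i = t - 1" if "i < n" for i
    using ww[OF that that] uc[OF that] by (simp add: K_def power2_eq_square)
  moreover have "K i j = -1" if "i < n" "j < n" "i \<noteq> j" "{i, j} \<notin> E" for i j
    using ww[OF that(1,2)] that u by (simp add: K_def orthonormal_rep_def)
  ultimately have "t \<in> theta_values n E" unfolding mem_theta_values_iff by blast
  with t show ?thesis by blast
qed

theorem theorem1:
  fixes n :: nat and E :: "nat set set"
  assumes "n \<ge> 1" and "simple_graph n E"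
  shows "is_minimum (rep_values n E) (theta_rep n E) \<and>
         is_minimum (theta_values n E) (lovasz_theta n E) \<and>
         theta_rep n E = ereal (lovasz_theta n E)"
proof -
  let ?m = "lovasz_theta n E"
  have min: "is_minimum (theta_values n E) ?m"
    using is_minimum_lovasz_theta[OF assms(1)] .
  have mem: "ereal ?m \<in> rep_values n E"
    using min theta_value_imp_rep_value[OF assms(1)] by (simp add: is_minimum_def)
  \<comment> \<open>Finite values are feasible reals, so the minimality of \<open>?m\<close>
    applies; the value \<open>\<infinity>\<close> is trivially above it.\<close>
  have lower: "ereal ?m \<le> v" if "v \<in> rep_values n E" for v
    using finite_rep_value_imp_theta_value[OF assms(1) that] min
    by (cases "v = \<infinity>") (auto simp: is_minimum_def)
  have "theta_rep n E = ereal ?m"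
    unfolding theta_rep_def using mem lower by (intro antisym Inf_lower Inf_greatest)
  with min mem lower show ?thesis by (simp add: is_minimum_def)
qed

end
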